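(* Let $G$ be a simple graph with $m$ edges. Then $$DSO(G)\leq \frac{m}{m+1}\sqrt{(m+1)^2-2}.$$
   Context: For a simple graph $G=(V,E)$, $d_u$ denotes the degree of vertex $u$. The Diminished Sombor index is $DSO(G)=\sum_{uv\in E}\frac{\sqrt{d_u^2+d_v^2}}{d_u+d_v}$. *)

theory Defs
  imports Complex_Main
begin

text \<open>Graphs are finite and undirected; an edge is a two-element set of vertices, so there
  are neither loops nor parallel edges.\<close>

definition simple_graph :: "'a set \<Rightarrow> 'a set set \<Rightarrow> bool" where
  "simple_graph V E \<longleftrightarrow> finite V \<and> (\<forall>e\<in>E. e \<subseteq> V \<and> card e = 2)"

definition degree :: "'a set set \<Rightarrow> 'a \<Rightarrow> nat" where
  "degree E v = card {e \<in> E. v \<in> e}"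

text \<open>The summand is symmetric in the two endpoints of an edge, so it is written with sums over
  the edge as a set; \<open>DSO_summand\<close> below gives it in terms of \<open>u\<close> and \<open>v\<close> for
  \<open>e = {u, v}\<close>.\<close>

definition DSO :: "'a set set \<Rightarrow> real" where
  "DSO E = (\<Sum>e\<in>E. sqrt (\<Sum>u\<in>e. (real (degree E u))\<^sup>2) / (\<Sum>u\<in>e. real (degree E u)))"

lemma DSO_summand:
  assumes "u \<noteq> v"
  shows "sqrt (\<Sum>w\<in>{u, v}. (real (degree E w))\<^sup>2) / (\<Sum>w\<in>{u, v}. real (degree E w))
    = sqrt ((real (degree E u))\<^sup>2 + (real (degree E v))\<^sup>2) / (real (degree E u) + real (degree E v))"
  using assms by simp

end

theory Submission
  imports Defs
begin

text \<open>The summand of an edge \<open>uv\<close> is \<open>sqrt (1 - 2 d\<^sub>u d\<^sub>v / (d\<^sub>u + d\<^sub>v)\<^sup>2)\<close>. Since \<open>uv\<close> is the only edge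
  containing both \<open>u\<close> and \<open>v\<close>, \<open>d\<^sub>u + d\<^sub>v \<le> m + 1\<close>, and \<open>d\<^sub>u d\<^sub>v \<ge> 1\<close>. Hence every one of
  the \<open>m\<close> summands is at most \<open>sqrt (1 - 2 / (m + 1)\<^sup>2)\<close>.\<close>

lemma simple_graph_finite_edges:
  assumes "simple_graph V E"
  shows "finite E"
proof (rule finite_subset)
  show "E \<subseteq> Pow V" "finite (Pow V)"
    using assms by (auto simp: simple_graph_def)
qed

lemma degree_pos:
  assumes "finite E" "e \<in> E" "v \<in> e"
  shows "degree E v \<ge> 1"
  using assms by (auto simp: degree_def Suc_le_eq card_gt_0_iff)

text \<open>Inclusion-exclusion for the edges at \<open>u\<close> and the edges at \<open>v\<close>:
  the union lies in \<open>E\<close>, and the overlap accounts for the extra 1.\<close>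

lemma degree_sum_le_edges:
  assumes "finite E" "\<forall>e\<in>E. card e = 2" "u \<noteq> v"
  shows "degree E u + degree E v \<le> card E + 1"
proof -
  let ?A = "{e \<in> E. u \<in> e}" and ?B = "{e \<in> E. v \<in> e}"
  have "e = {u, v}" if "e \<in> ?A \<inter> ?B" for e
    using that assms(2,3) by (auto simp: card_2_iff)
  then have "card (?A \<inter> ?B) \<le> card {{u, v}}"
    by (intro card_mono) auto
  moreover have "card (?A \<union> ?B) \<le> card E"
    using assms(1) by (intro card_mono) auto
  moreover have "card ?A + card ?B = card (?A \<union> ?B) + card (?A \<inter> ?B)"
    using assms(1) by (intro card_Un_Int) auto
  ultimately show ?thesis
    by (simp add: degree_def)
qed

text \<open>After clearing denominators and squaring, the claim amounts to
  \<open>(a + b)\<^sup>2 \<le> a * b * s\<^sup>2\<close>, which is proved first.\<close>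

lemma sqrt_sum_squares_over_sum_le:
  fixes a b s :: real
  assumes "a \<ge> 1" "b \<ge> 1" "a + b \<le> s"
  shows "sqrt (a\<^sup>2 + b\<^sup>2) / (a + b) \<le> sqrt (s\<^sup>2 - 2) / s"
proof -
  have "(a + b)\<^sup>2 \<le> s\<^sup>2"
    using assms by (intro power_mono) auto
  also have "s\<^sup>2 \<le> (a * b) * s\<^sup>2"
    using mult_right_mono[of 1 "a * b" "s\<^sup>2"] mult_mono[of 1 a 1 b] assms by simp
  \<comment> \<open>Double the chained inequality and use
    \<open>a\<^sup>2 + b\<^sup>2 = (a + b)\<^sup>2 - 2 * a * b\<close>.\<close>
  finally have "(a\<^sup>2 + b\<^sup>2) * s\<^sup>2 \<le> (s\<^sup>2 - 2) * (a + b)\<^sup>2"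
    by (simp add: power2_eq_square algebra_simps)
  then have "sqrt ((a\<^sup>2 + b\<^sup>2) * s\<^sup>2) \<le> sqrt ((s\<^sup>2 - 2) * (a + b)\<^sup>2)"
    by (rule real_sqrt_le_mono)
  then have "sqrt (a\<^sup>2 + b\<^sup>2) * s \<le> sqrt (s\<^sup>2 - 2) * (a + b)"
    using assms by (simp add: real_sqrt_mult)
  then show ?thesis
    using assms by (simp add: field_simps)
qed

theorem theorem3p5:
  fixes V :: "'a set" and E :: "'a set set" and m :: nat
  assumes "simple_graph V E"
    and "card E = m"
  shows "DSO E \<le> real m / (real m + 1) * sqrt ((real m + 1)\<^sup>2 - 2)"
proof -
  have fin: "finite E" and two: "\<forall>e\<in>E. card e = 2"
    using assms(1) simple_graph_finite_edges by (auto simp: simple_graph_def)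
  have "DSO E \<le> real (card E) * (sqrt ((real m + 1)\<^sup>2 - 2) / (real m + 1))"
    unfolding DSO_def
  \<comment> \<open>It suffices to bound each summand by a constant independent of the edge.\<close>
  proof (rule sum_bounded_above)
    fix e assume "e \<in> E"
    then obtain u v where e: "e = {u, v}" "u \<noteq> v"
      using two by (auto simp: card_2_iff)
    have "degree E u \<ge> 1" "degree E v \<ge> 1"
      using degree_pos[OF fin \<open>e \<in> E\<close>] e by auto
    moreover have "degree E u + degree E v \<le> m + 1"
      using degree_sum_le_edges[OF fin two e(2)] assms(2) by simp
    ultimately show "sqrt (\<Sum>w\<in>e. (real (degree E w))\<^sup>2) / (\<Sum>w\<in>e. real (degree E w))
        \<le> sqrt ((real m + 1)\<^sup>2 - 2) / (real m + 1)"
      unfolding e(1) DSO_summand[OF e(2)] by (intro sqrt_sum_squares_over_sum_le) auto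
  qed
  then show ?thesis
    by (simp add: assms(2))
qed

end
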